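(* Let $n,m\ge 1$ be integers, let $\Omega\subset\mathbb{R}^n$ be an open bounded set with smooth boundary, let $\tilde\Omega=\Omega-\Omega=\{x-x' : x,x'\in\Omega\}$, and let $w:\Omega\times\tilde\Omega\times\mathbb{R}^m\to\mathbb{R}$ be a pairwise potential function. Assume there exists $\beta\in\mathbb{R}$ such that the limit $$w^\circ(x,\tilde x,\tilde y):=\lim_{t\to 0}\frac{1}{t^\beta}\,w(x,t\tilde x,t\tilde y)$$ exists for a.e. $x\in\Omega$ and all $\tilde x,\tilde y$, so that $w^\circ$ is defined. Suppose that $w$ satisfies $$w(x,\tilde x,\tilde y)=w(x,\tilde x,R\tilde y)\qquad\text{for a.e. }x\in\Omega,\ \text{all }\tilde x\in\tilde\Omega,\ \tilde y\in\mathbb{R}^m,\ R\in SO(m),$$ and $$w(x,\tilde x,\tilde y)=w(x,R\tilde x,\tilde y)\qquad\text{for a.e. }x\in\Omega,\ \text{all }\tilde x\in\tilde\Omega,\ \tilde y\in\mathbb{R}^m,\ R\in SO(n).$$ Define $$\bar w(x,A):=\int_{\mathbb{S}^{n-1}}w^\circ(x,z,Az)\,d\mathcal{H}^{n-1}(z),\qquad x\in\Omega,\ A\in\mathbb{R}^{m\times n},$$ and let $W:=\bar w^{qc}$, where $\bar w^{qc}(x,\cdot)$ is the quasiconvexification of $\bar w(x,\cdot)$. Then for a.e. $x\in\Omega$ and all $A\in\mathbb{R}^{m\times n}$: $$W(x,RA)=W(x,A)\ \text{ for all } R\in SO(m),\qquad\text{and}\qquad W(x,AR)=W(x,A)\ \text{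 for all } R\in SO(n).$$
   Context: $SO(k)=\{Q\in\mathbb{R}^{k\times k}:\det Q=1,\ QQ^T=I_k\}$. $\mathbb{S}^{n-1}$ is the unit sphere of $\mathbb{R}^n$ and $\mathcal{H}^{n-1}$ is the $(n-1)$-dimensional Hausdorff (surface) measure. The limit defining $w^\circ$ is as $t\to0^+$; since $\tilde\Omega$ is a neighbourhood of $0$, $t\tilde x\in\tilde\Omega$ for $t$ small, so $w^\circ(x,z,\cdot)$ makes sense for $z\in\mathbb{S}^{n-1}$; identities for $w$ involving a point $R\tilde x$ are understood whenever $R\tilde x\in\tilde\Omega$. The integrals defining $\bar w$ are assumed to be well defined. A function $\psi:\mathbb{R}^{m\times n}\to\mathbb{R}$ is quasiconvex if $\psi(A)\le\int_{(0,1)^n}\psi(A+Dv(x))\,dx$ for all $A\in\mathbb{R}^{m\times n}$ and all $v\in C_c^\infty((0,1)^n,\mathbb{R}^m)$. The quasiconvexification is $$\bar w^{qc}(x,A):=\sup\{v(x,A): v(x,\cdot)\le\bar w(x,\cdot)\text{ and }v(x,\cdot)\text{ quasiconvex}\}.$$ *)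

theory Defs
  imports "HOL-Analysis.Analysis"
begin

section \<open>Hausdorff measure\<close>

text \<open>
  Coverings use arbitrary bounded sets (\<^const>\<open>diameter\<close> is meaningless for unbounded ones). The
  normalisation \<open>unit_ball_vol k * (diameter C / 2) ^ k\<close> is the one for which the
  \<open>k\<close>-dimensional measure agrees with surface measure. With \<open>0 ^ 0 = 1\<close>, nonempty sets have size
  \<open>1\<close> when \<open>k = 0\<close>, so that the \<open>0\<close>-dimensional measure is the counting measure.
\<close>

definition hausdorff_size :: "nat \<Rightarrow> 'a::metric_space set \<Rightarrow> ennreal" where
  "hausdorff_size k C =
     (if C = {} then 0 else ennreal (unit_ball_vol (real k) * (diameter C / 2) ^ k))"

definition hausdorff_covers :: "real \<Rightarrow> 'a::metric_space set \<Rightarrow> (nat \<Rightarrow> 'a set) set" where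
  "hausdorff_covers \<delta> S = {C. S \<subseteq> (\<Union>i. C i) \<and> (\<forall>i. bounded (C i) \<and> diameter (C i) \<le> \<delta>)}"

definition hausdorff_outer :: "nat \<Rightarrow> 'a::metric_space set \<Rightarrow> ennreal" where
  "hausdorff_outer k S =
     (SUP \<delta>\<in>{0<..}. INF C\<in>hausdorff_covers \<delta> S. \<Sum>i. hausdorff_size k (C i))"

text \<open>The measure lives on the sigma-algebra of all Caratheodory-measurable sets.\<close>

definition hausdorff_measure :: "nat \<Rightarrow> 'a::metric_space measure" where
  "hausdorff_measure k =
     measure_of UNIV (lambda_system UNIV UNIV (hausdorff_outer k)) (hausdorff_outer k)"

lemma hausdorff_outer_mono:
  assumes "S \<subseteq> T"
  shows "hausdorff_outer k S \<le> hausdorff_outer k T"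
  unfolding hausdorff_outer_def
  by (intro SUP_mono' INF_superset_mono) (use assms in \<open>auto simp: hausdorff_covers_def\<close>)

lemma hausdorff_outer_empty: "hausdorff_outer k {} = 0"
proof -
  have "(INF C\<in>hausdorff_covers \<delta> {}. \<Sum>i. hausdorff_size k (C i :: 'a set)) = 0" if "\<delta> > 0" for \<delta>
  proof -
    have "(\<lambda>i. {}) \<in> hausdorff_covers \<delta> ({} :: 'a set)"
      using that by (auto simp: hausdorff_covers_def)
    then have "(INF C\<in>hausdorff_covers \<delta> {}. \<Sum>i. hausdorff_size k (C i :: 'a set))
        \<le> (\<Sum>i. hausdorff_size k ({} :: 'a set))"
      by (rule INF_lower)
    then show ?thesis by (simp add: hausdorff_size_def)
  qed
  then show ?thesis by (simp add: hausdorff_outer_def)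
qed

lemma hausdorff_outer_subadditive:
  fixes S :: "nat \<Rightarrow> 'a::metric_space set"
  shows "hausdorff_outer k (\<Union>i. S i) \<le> (\<Sum>i. hausdorff_outer k (S i))"
  unfolding hausdorff_outer_def[of k "\<Union>i. S i"]
proof (rule SUP_least)
  fix \<delta> :: real assume "\<delta> \<in> {0<..}"
  let ?h = "\<lambda>T. INF C\<in>hausdorff_covers \<delta> T. \<Sum>i. hausdorff_size k (C i :: 'a set)"
  have le: "?h T \<le> hausdorff_outer k T" for T
    unfolding hausdorff_outer_def using \<open>\<delta> \<in> {0<..}\<close> by (rule SUP_upper)
  show "?h (\<Union>i. S i) \<le> (\<Sum>i. hausdorff_outer k (S i))"
  proof (cases "(\<Sum>i. hausdorff_outer k (S i)) = top")
    case False
    have fin: "?h (S i) < top" for i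
    proof -
      have "hausdorff_outer k (S i) < top"
        using False by (intro ennreal_suminf_lessD[where f = "\<lambda>i. hausdorff_outer k (S i)"])
          (simp add: less_top)
      then show ?thesis using le by (rule le_less_trans[rotated])
    qed
    show ?thesis
    proof (rule ennreal_le_epsilon)
      fix e :: real assume e: "0 < e"
      have "\<exists>C\<in>hausdorff_covers \<delta> (S i).
              (\<Sum>j. hausdorff_size k (C j)) < ?h (S i) + ennreal (e * (1/2)^Suc i)" for i
      proof -
        have "?h (S i) < ?h (S i) + ennreal (e * (1/2)^Suc i)"
          using fin[of i] e by (cases "?h (S i)") (auto simp flip: ennreal_plus simp: ennreal_less_iff)
        then show ?thesis by (simp only: INF_less_iff)
      qed
      then obtain C where C: "\<And>i. C i \<in> hausdorff_covers \<delta> (S i)"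
        "\<And>i. (\<Sum>j. hausdorff_size k (C i j)) < ?h (S i) + ennreal (e * (1/2)^Suc i)"
        by metis
      let ?D = "\<lambda>p. case prod_decode p of (i, j) \<Rightarrow> C i j"
      have "?D \<in> hausdorff_covers \<delta> (\<Union>i. S i)"
        using C(1) unfolding hausdorff_covers_def
        by (auto split: prod.splits) (metis UN_iff case_prod_conv prod_encode_inverse subsetD UNIV_I)
      then have "?h (\<Union>i. S i) \<le> (\<Sum>p. hausdorff_size k (?D p))"
        by (rule INF_lower)
      also have "\<dots> = (\<Sum>i. \<Sum>j. hausdorff_size k (C i j))"
        using suminf_ennreal_2dimen[where f = "\<lambda>(i, j). hausdorff_size k (C i j)", OF refl]
        by (simp add: o_def case_prod_beta)
      also have "\<dots> \<le> (\<Sum>i. hausdorff_outer k (S i) + ennreal (e * (1/2)^Suc i))"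
        using C(2) le by (intro suminf_le) (auto intro!: order.trans[OF less_imp_le add_right_mono])
      also have "\<dots> = (\<Sum>i. hausdorff_outer k (S i)) + (\<Sum>i. ennreal (e * (1/2)^Suc i))"
        by (rule suminf_add[symmetric]) auto
      also have "(\<Sum>i. ennreal (e * (1/2)^Suc i)) = ennreal e"
        using e sums_mult[OF power_half_series, of e]
        by (intro suminf_ennreal_eq) auto
      finally show "?h (\<Union>i. S i) \<le> (\<Sum>i. hausdorff_outer k (S i)) + ennreal e" .
    qed
  qed simp
qed

lemma
  fixes S :: "'a::metric_space set"
  shows sets_hausdorff_measure:
      "sets (hausdorff_measure k :: 'a measure) = lambda_system UNIV UNIV (hausdorff_outer k)" (is ?s)
    and emeasure_hausdorff_measure:
      "S \<in> sets (hausdorff_measure k) \<Longrightarrow> emeasure (hausdorff_measure k) S = hausdorff_outer k S"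
proof -
  let ?f = "hausdorff_outer k :: 'a set \<Rightarrow> ennreal"
  have "outer_measure_space (Pow UNIV) ?f"
    using hausdorff_outer_subadditive hausdorff_outer_mono hausdorff_outer_empty
    by (auto simp: outer_measure_space_def positive_def increasing_def countably_subadditive_def)
  then have "measure_space UNIV (lambda_system UNIV UNIV ?f) ?f"
    using sigma_algebra.caratheodory_lemma[OF sigma_algebra_Pow, of "UNIV :: 'a set" ?f] by simp
  then show s: ?s
    and "S \<in> sets (hausdorff_measure k) \<Longrightarrow> emeasure (hausdorff_measure k) S = hausdorff_outer k S"
    unfolding hausdorff_measure_def
    by (auto simp: measure_space_def sigma_algebra.sigma_sets_eq
        intro!: emeasure_measure_of_sigma)
qed


section \<open>Smooth functions and smooth domains\<close>

fun C_k :: "nat \<Rightarrow> ('a::euclidean_space \<Rightarrow> 'b::real_normed_vector) \<Rightarrow> bool" where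
  "C_k 0 f \<longleftrightarrow> continuous_on UNIV f"
| "C_k (Suc k) f \<longleftrightarrow> (\<forall>x. f differentiable (at x)) \<and>
     (\<forall>b\<in>Basis. C_k k (\<lambda>x. frechet_derivative f (at x) b))"

definition smooth :: "('a::euclidean_space \<Rightarrow> 'b::real_normed_vector) \<Rightarrow> bool" where
  "smooth f \<longleftrightarrow> (\<forall>k. C_k k f)"

text \<open>
  Near each boundary point \<open>p\<close> the set is the region above a smooth graph, in coordinates adapted to
  some unit vector \<open>e\<close>; \<open>y - (y \<bullet> e) *\<^sub>R e\<close> is the orthogonal projection onto the hyperplane normal to \<open>e\<close>.
\<close>

definition smooth_boundary :: "'a::euclidean_space set \<Rightarrow> bool" where
  "smooth_boundary S \<longleftrightarrow>
     (\<forall>p\<in>frontier S. \<exists>r>0. \<exists>e. \<exists>\<gamma> :: 'a \<Rightarrow> real. norm e = 1 \<and> smooth \<gamma> \<and>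
        S \<inter> ball p r = {y \<in> ball p r. y \<bullet> e > \<gamma> (y - (y \<bullet> e) *\<^sub>R e)})"

definition test_functions :: "'a::euclidean_space set \<Rightarrow> ('a \<Rightarrow> 'b::real_normed_vector) set" where
  "test_functions U =
     {v. smooth v \<and> compact (closure {x. v x \<noteq> 0}) \<and> closure {x. v x \<noteq> 0} \<subseteq> U}"


section \<open>Quasiconvexity\<close>

text \<open>
  Integrability is required explicitly, since the Bochner integral of a non-integrable function is
  \<open>0\<close> by convention. Here \<open>box 0 1\<close> is the open unit cube: \<open>1\<close> is the vector with all entries \<open>1\<close>.
\<close>

definition quasiconvex :: "(real^'n^'m \<Rightarrow> real) \<Rightarrow> bool" where
  "quasiconvex \<psi> \<longleftrightarrow>
     (\<forall>A. \<forall>v \<in> test_functions (box 0 1) :: (real^'n \<Rightarrow> real^'m) set.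
        set_integrable lebesgue (box 0 1) (\<lambda>x. \<psi> (A + jacobian v (at x))) \<and>
        \<psi> A \<le> (LINT x:box 0 1|lebesgue. \<psi> (A + jacobian v (at x))))"

text \<open>The value is extended real because the set of quasiconvex minorants may be empty.\<close>

definition quasiconvexification :: "(real^'n^'m \<Rightarrow> real) \<Rightarrow> real^'n^'m \<Rightarrow> ereal" where
  "quasiconvexification f A = (SUP g\<in>{g. (\<forall>B. g B \<le> f B) \<and> quasiconvex g}. ereal (g A))"


section \<open>Pairwise potentials\<close>

definition difference_set :: "'a::ab_group_add set \<Rightarrow> 'a set" where
  "difference_set S = {x - x' | x x'. x \<in> S \<and> x' \<in> S}"

text \<open>
  A potential \<open>w\<close> is a total function; only its values at \<open>x \<in> \<Omega>\<close> and \<open>z \<in> difference_set \<Omega>\<close>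
  are ever relevant. In particular, for open \<open>\<Omega>\<close> and \<open>x \<in> \<Omega>\<close> the limit below only sees such values.
\<close>

definition rescaled_potential ::
  "real \<Rightarrow> (real^'n \<Rightarrow> real^'n \<Rightarrow> real^'m \<Rightarrow> real) \<Rightarrow> real^'n \<Rightarrow> real^'n \<Rightarrow> real^'m \<Rightarrow> real \<Rightarrow> real"
where
  "rescaled_potential \<beta> w x z y t = 1 / t powr \<beta> * w x (t *\<^sub>R z) (t *\<^sub>R y)"

definition limit_potential ::
  "real \<Rightarrow> (real^'n \<Rightarrow> real^'n \<Rightarrow> real^'m \<Rightarrow> real) \<Rightarrow> real^'n \<Rightarrow> real^'n \<Rightarrow> real^'m \<Rightarrow> real"
where
  "limit_potential \<beta> w x z y = Lim (at_right 0) (rescaled_potential \<beta> w x z y)"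

definition local_density ::
  "real \<Rightarrow> (real^'n \<Rightarrow> real^'n \<Rightarrow> real^'m \<Rightarrow> real) \<Rightarrow> real^'n \<Rightarrow> real^'n^'m \<Rightarrow> real"
where
  "local_density \<beta> w x A =
     (LINT z:sphere 0 1|hausdorff_measure (CARD('n) - 1). limit_potential \<beta> w x z (A *v z))"

end

theory Submission
  imports Defs
begin

text \<open>
  Fix a point \<open>x\<close> of \<open>\<Omega>\<close> outside the exceptional null sets and write \<open>f\<close> for the local density at \<open>x\<close>.
  Rescaled arguments \<open>t z\<close> eventually lie in the difference set, so both symmetries of the potential
  pass to its limit. Left multiplication of \<open>A\<close> by a rotation then leaves the integrand of \<open>f A\<close>
  unchanged, and right multiplication by a rotation only rotates the variable of integration, under
  which Hausdorff measure on the sphere is invariant (\<open>distr_hausdorff_isometry\<close>). Hence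
  \<open>f (S A R) = f A\<close> for rotations \<open>S\<close> and \<open>R\<close>.

  The quasiconvexification inherits this symmetry as soon as \<open>g (S A R)\<close> is a quasiconvex function
  of \<open>A\<close> whenever \<open>g\<close> is quasiconvex: composition with \<open>A \<mapsto> S A R\<close> then permutes the quasiconvex
  minorants of \<open>f\<close>. This is \<open>quasiconvex_linear_change\<close>. The matrix \<open>S\<close> is absorbed by replacing a
  test function \<open>v\<close> by \<open>S v\<close>. The matrix \<open>R\<close> requires precomposing \<open>v\<close> with a linear map, which moves
  the support out of the unit cube. The remedy rests on the fact that the excess
  \<open>g (A + Dv) - g A\<close> vanishes outside the support of \<open>v\<close>. Quasiconvexity therefore says that the
  integral of the excess over the whole space is nonnegative (\<open>quasiconvex_iff_excess\<close>), and the sign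
  of such an integral is unchanged by any affine bijection. A strong contraction about the centre of
  the cube brings the support back into the cube.

  Since only the sign of the integral matters, it suffices to know that an affine bijection multiplies
  Lebesgue measure by some positive constant. That follows from the uniqueness of
  translation-invariant measures (\<open>translation_invariant_nn_integral\<close>).
\<close>

section \<open>Lebesgue measure under affine bijections\<close>

text \<open>
  This is the uniqueness of Haar measure on a Euclidean space, in a form symmetric in \<open>f\<close> and \<open>g\<close>: in the double
  integral of \<open>f x * g y\<close> the substitution \<open>y \<mapsto> x + y\<close> is allowed by the invariance of Lebesgue measure,
  then \<open>x \<mapsto> x - y\<close> by the invariance of \<open>M\<close>, and the reflection \<open>y \<mapsto> x - y\<close> disposes of the
  argument of \<open>f\<close>.
\<close>

lemma translation_invariant_nn_integral:
  fixes M :: "'a::euclidean_space measure" and f g :: "'a \<Rightarrow> ennreal"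
  assumes sets [measurable_cong]: "sets M = sets borel" and "sigma_finite_measure M"
    and trans: "\<And>a. distr M borel ((+) a) = M"
    and f [measurable]: "f \<in> borel_measurable borel" and g [measurable]: "g \<in> borel_measurable borel"
  shows "(\<integral>\<^sup>+x. f x \<partial>M) * (\<integral>\<^sup>+y. g y \<partial>lborel) = (\<integral>\<^sup>+x. g x \<partial>M) * (\<integral>\<^sup>+y. f y \<partial>lborel)"
proof -
  interpret M: sigma_finite_measure M by fact
  interpret P: pair_sigma_finite M "lborel :: 'a measure" ..
  have shift: "(\<integral>\<^sup>+x. h (a + x) \<partial>M) = (\<integral>\<^sup>+x. h x \<partial>M)"
    if "h \<in> borel_measurable borel" for h :: "'a \<Rightarrow> ennreal" and a
    using nn_integral_distr[of "(+) a" M borel h] trans[of a] that by simp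
  have shift_lborel: "(\<integral>\<^sup>+x. h (a + x) \<partial>lborel) = (\<integral>\<^sup>+x. h x \<partial>lborel)"
    if "h \<in> borel_measurable borel" for h :: "'a \<Rightarrow> ennreal" and a
    using nn_integral_distr[of "(+) a" lborel borel h] lborel_distr_plus[of a] that by simp
  have reflect: "(\<integral>\<^sup>+y. f (x - y) \<partial>lborel) = (\<integral>\<^sup>+y. f y \<partial>lborel)" for x
    using lborel_affine[of "-1" x] nn_integral_distr[of "\<lambda>y. x - y" lborel borel f]
    by (simp add: density_1)
  have "(\<integral>\<^sup>+x. f x \<partial>M) * (\<integral>\<^sup>+y. g y \<partial>lborel) = (\<integral>\<^sup>+x. \<integral>\<^sup>+y. f x * g y \<partial>lborel \<partial>M)"
    by (simp add: nn_integral_cmult nn_integral_multc)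
  also have "\<dots> = (\<integral>\<^sup>+x. \<integral>\<^sup>+y. f x * g (x + y) \<partial>lborel \<partial>M)"
    by (simp add: nn_integral_cmult shift_lborel)
  also have "\<dots> = (\<integral>\<^sup>+y. \<integral>\<^sup>+x. f x * g (x + y) \<partial>M \<partial>lborel)"
    by (rule P.Fubini'[symmetric]) measurable
  also have "\<dots> = (\<integral>\<^sup>+y. \<integral>\<^sup>+x. f (x - y) * g x \<partial>M \<partial>lborel)"
    using shift[of "\<lambda>x. f (x - y) * g x" y for y] by (simp add: add.commute)
  also have "\<dots> = (\<integral>\<^sup>+x. \<integral>\<^sup>+y. f (x - y) * g x \<partial>lborel \<partial>M)"
    by (rule P.Fubini') measurable
  also have "\<dots> = (\<integral>\<^sup>+x. g x \<partial>M) * (\<integral>\<^sup>+y. f y \<partial>lborel)"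
    by (simp add: nn_integral_multc nn_integral_cmult reflect) (simp add: mult.commute)
  finally show ?thesis .
qed

text \<open>
  The image measure is translation invariant, because translating by \<open>a\<close> after \<open>f\<close> is translating by the
  preimage of \<open>a\<close> before it. It is thus a multiple of Lebesgue measure; comparing the two on the
  unit ball shows that the factor is finite and positive. The factor is of course the inverse of the
  absolute value of the determinant of \<open>f\<close>; only its positivity is used below.
\<close>

lemma affine_distr_lborel:
  fixes f :: "'a::euclidean_space \<Rightarrow> 'a"
  assumes f: "linear f" "inj f"
  obtains \<kappa> :: real where "\<kappa> > 0" "distr lborel borel (\<lambda>x. q + f x) = density lborel (\<lambda>_. ennreal \<kappa>)"
proof -
  let ?T = "\<lambda>x. q + f x"
  define M where "M = distr lborel borel ?T"
  define B :: "'a set" where "B = ball 0 1"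
  obtain g where g: "linear g" "\<And>x. g (f x) = x" "\<And>x. f (g x) = x"
    using linear_injective_isomorphism[OF f] by blast
  have [measurable]: "f \<in> borel_measurable borel" "g \<in> borel_measurable borel"
    using f(1) g(1) by (auto intro!: borel_measurable_continuous_onI linear_continuous_on simp: linear_conv_bounded_linear)
  have sets [simp, measurable_cong]: "sets M = sets borel" by (simp add: M_def)
  \<comment> \<open>Sigma-finiteness is pulled back along the inverse map, whose image measure is Lebesgue measure.\<close>
  have inverse: "distr M borel (\<lambda>y. g (y - q)) = lborel"
    by (simp add: M_def distr_distr comp_def g distr_id2)
  have "sigma_finite_measure (distr M borel (\<lambda>y. g (y - q)))"
    unfolding inverse by (rule lborel.sigma_finite_measure_axioms)
  then have sigma: "sigma_finite_measure M"
    by (rule sigma_finite_measure_distr) simp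
  have trans: "distr M borel ((+) a) = M" for a
  proof -
    have "distr M borel ((+) a) = distr (distr lborel borel ((+) (g a))) borel ?T"
      by (simp add: M_def distr_distr comp_def linear_add[OF f(1)] g add_ac)
    then show ?thesis by (simp add: lborel_distr_plus M_def)
  qed
  have ratio: "emeasure M A * emeasure lborel B = emeasure M B * emeasure lborel A" if "A \<in> sets borel" for A
    using translation_invariant_nn_integral[OF sets sigma trans, of "indicator A" "indicator B"] that
    by (simp add: B_def borel_measurable_indicator)
  have vim: "?T -` B = (\<lambda>y. g (y - q)) ` B"
    by (force simp: g image_iff)
  have MB: "emeasure M B = emeasure lborel ((\<lambda>y. g (y - q)) ` B)"
    unfolding vim[symmetric] by (simp add: M_def emeasure_distr B_def)
  have "bounded ((\<lambda>y. g (y - q)) ` B)"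
    using bounded_linear_image[of "(\<lambda>y. y - q) ` B" g] g(1) bounded_translation_minus[of B q]
    by (simp add: image_image B_def linear_conv_bounded_linear)
  then have finM: "emeasure M B < \<infinity>"
    unfolding MB by (rule emeasure_bounded_finite)
  have b: "0 < emeasure lborel B" "emeasure lborel B < \<infinity>"
    unfolding B_def by (simp add: emeasure_ball) (rule emeasure_lborel_ball_finite)
  have "emeasure M B \<noteq> 0"
  proof
    \<comment> \<open>Otherwise \<open>M\<close> would vanish, although its total mass is that of Lebesgue measure.\<close>
    assume "emeasure M B = 0"
    then have "emeasure M UNIV = 0" using ratio[of UNIV] b by auto
    moreover have "emeasure M UNIV = emeasure lborel (UNIV :: 'a set)"
      by (simp add: M_def emeasure_distr)
    ultimately show False by simp
  qed
  then obtain m where m: "emeasure M B = ennreal m" "m > 0"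
    using finM by (cases "emeasure M B") (auto simp: less_le)
  obtain c where c: "emeasure lborel B = ennreal c" "c > 0"
    using b by (cases "emeasure lborel B") auto
  show ?thesis
  proof (rule that[of "m / c"])
    show "m / c > 0" using m c by simp
    show "distr lborel borel ?T = density lborel (\<lambda>_. ennreal (m / c))"
      unfolding M_def[symmetric]
    proof (rule measure_eqI)
      fix A assume "A \<in> sets M"
      then have A: "A \<in> sets borel" by simp
      have "emeasure M A = emeasure M A * ennreal c * ennreal (1 / c)"
        using c by (simp add: mult.assoc flip: ennreal_mult)
      also have "\<dots> = ennreal m * ennreal (1 / c) * emeasure lborel A"
        using ratio[OF A] m c by (simp add: ac_simps)
      also have "\<dots> = ennreal (m / c) * emeasure lborel A"
        using m c by (simp flip: ennreal_mult)
      finally show "emeasure M A = emeasure (density lborel (\<lambda>_. ennreal (m / c))) A"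
        using A by (simp add: emeasure_density nn_integral_cmult_indicator)
    qed simp
  qed
qed

text \<open>
  Completion turns the statement about Borel measure into one about Lebesgue measure: the image
  measure has the same null sets, so an affine bijection is measurable for the completed
  sigma-algebras.
\<close>

lemma lebesgue_integral_affine:
  fixes f :: "'a::euclidean_space \<Rightarrow> 'a"
  assumes f: "linear f" "inj f"
  shows "\<exists>\<kappa>>0. \<forall>k :: 'a \<Rightarrow> real. integrable lebesgue k \<longrightarrow>
    integrable lebesgue (\<lambda>x. k (q + f x)) \<and> (LINT x|lebesgue. k (q + f x)) = \<kappa> * (LINT x|lebesgue. k x)"
proof -
  obtain \<kappa> where \<kappa>: "\<kappa> > 0" "distr lborel borel (\<lambda>x. q + f x) = density lborel (\<lambda>_. ennreal \<kappa>)"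
    using affine_distr_lborel[OF f] .
  have [measurable]: "f \<in> borel_measurable borel"
    using f(1) by (auto intro!: borel_measurable_continuous_onI linear_continuous_on simp: linear_conv_bounded_linear)
  have null: "null_sets (distr lebesgue lborel (\<lambda>x. q + f x)) = null_sets lborel"
  proof -
    have "distr lebesgue lborel (\<lambda>x. q + f x) = density lborel (\<lambda>_. ennreal \<kappa>)"
      by (simp add: distr_completion \<kappa>(2)[symmetric] cong: distr_cong)
    moreover have "null_sets (density lborel (\<lambda>_. ennreal \<kappa>)) = null_sets (lborel :: 'a measure)"
      using \<kappa>(1) by (auto simp: null_sets_def emeasure_density nn_integral_cmult_indicator)
    ultimately show ?thesis by simp
  qed
  have T: "(\<lambda>x. q + f x) \<in> lebesgue \<rightarrow>\<^sub>M lebesgue"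
    by (simp add: completion.measurable_completion2 null measurable_completion)
  have "distr lebesgue lebesgue (\<lambda>x. q + f x) = completion (distr lebesgue lborel (\<lambda>x. q + f x))"
    by (subst completion.completion_distr_eq) (auto simp: null measurable_completion)
  also have "\<dots> = completion (density lborel (\<lambda>_. ennreal \<kappa>))"
    by (simp add: distr_completion \<kappa>(2)[symmetric] cong: distr_cong)
  also have "\<dots> = density lebesgue (\<lambda>_. ennreal \<kappa>)"
    using \<kappa>(1) by (intro completion_density_eq) auto
  finally have D: "distr lebesgue lebesgue (\<lambda>x. q + f x) = density lebesgue (\<lambda>_. ennreal \<kappa>)" .
  have "integrable lebesgue (\<lambda>x. k (q + f x)) \<and> (LINT x|lebesgue. k (q + f x)) = \<kappa> * (LINT x|lebesgue. k x)"
    if k: "integrable lebesgue k" for k :: "'a \<Rightarrow> real"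
  proof
    have meas: "k \<in> borel_measurable lebesgue" using k by simp
    have "integrable (distr lebesgue lebesgue (\<lambda>x. q + f x)) k"
      unfolding D using \<kappa>(1) k meas by (subst integrable_density) auto
    then show "integrable lebesgue (\<lambda>x. k (q + f x))"
      using T meas by (subst (asm) integrable_distr_eq) auto
    have "(LINT x|lebesgue. k (q + f x)) = integral\<^sup>L (distr lebesgue lebesgue (\<lambda>x. q + f x)) k"
      using T meas by (rule integral_distr[symmetric])
    also have "\<dots> = \<kappa> * (LINT x|lebesgue. k x)"
      unfolding D using \<kappa>(1) meas by (subst integral_density) auto
    finally show "(LINT x|lebesgue. k (q + f x)) = \<kappa> * (LINT x|lebesgue. k x)" .
  qed
  with \<kappa>(1) show ?thesis by blast
qed

section \<open>Smooth functions and their derivatives\<close>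

lemma frechet_derivative_bounded_linear:
  assumes L: "bounded_linear L" and "f differentiable (at x)"
  shows "frechet_derivative (\<lambda>x. L (f x)) (at x) = (\<lambda>h. L (frechet_derivative f (at x) h))"
  using bounded_linear.has_derivative[OF L frechet_derivative_works[THEN iffD1, OF assms(2)]]
  by (simp add: frechet_derivative_at[symmetric])

lemma C_k_bounded_linear:
  assumes L: "bounded_linear L"
  shows "C_k k f \<Longrightarrow> C_k k (\<lambda>x. L (f x))"
proof (induction k arbitrary: f)
  case 0
  then show ?case by (auto intro: bounded_linear.continuous_on[OF L])
next
  case (Suc k)
  then have d: "f differentiable (at x)" for x by simp
  have "(\<lambda>x. L (f x)) differentiable (at x)" for x
    using bounded_linear.has_derivative[OF L] d[of x] unfolding differentiable_def by blast
  then show ?case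
    using Suc by (simp add: frechet_derivative_bounded_linear[OF L d])
qed

lemma C_k_zero: "C_k k (\<lambda>x. 0)"
  by (induction k) (auto simp: frechet_derivative_const)

lemma C_k_add: "C_k k f \<Longrightarrow> C_k k g \<Longrightarrow> C_k k (\<lambda>x. f x + g x)"
proof (induction k arbitrary: f g)
  case (Suc k)
  then have "f differentiable (at x)" "g differentiable (at x)" for x by simp_all
  then have "frechet_derivative (\<lambda>x. f x + g x) (at x)
      = (\<lambda>h. frechet_derivative f (at x) h + frechet_derivative g (at x) h)" for x
    by (intro frechet_derivative_at[symmetric] has_derivative_add)
      (simp_all flip: frechet_derivative_works)
  then show ?case using Suc by auto
qed (auto intro: continuous_on_add)

lemma C_k_sum: "finite I \<Longrightarrow> (\<And>i. i \<in> I \<Longrightarrow> C_k k (f i)) \<Longrightarrow> C_k k (\<lambda>x. \<Sum>i\<in>I. f i x)"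
  by (induction I rule: finite_induct) (auto intro: C_k_add C_k_zero)

lemma has_derivative_compose_affine:
  fixes l :: "'c::euclidean_space \<Rightarrow> 'a::euclidean_space" and f :: "'a \<Rightarrow> 'b::real_normed_vector"
  assumes l: "linear l" and f: "f differentiable (at (q + l x))"
  shows "((\<lambda>x. f (q + l x)) has_derivative (\<lambda>h. frechet_derivative f (at (q + l x)) (l h))) (at x)"
proof -
  have "((\<lambda>x. q + l x) has_derivative l) (at x)"
    using l by (auto intro!: derivative_eq_intros linear_imp_has_derivative)
  from has_derivative_compose[OF this frechet_derivative_works[THEN iffD1, OF f]] show ?thesis .
qed

text \<open>
  By the chain rule, a partial derivative of the composition is a linear combination, with constant
  coefficients, of partial derivatives of \<open>f\<close> composed with the same affine map. The induction on
  the order of differentiability closes for this reason.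
\<close>

lemma C_k_affine:
  fixes l :: "'c::euclidean_space \<Rightarrow> 'a::euclidean_space"
  assumes l: "linear l"
  shows "C_k k f \<Longrightarrow> C_k k (\<lambda>x. f (q + l x))"
proof (induction k arbitrary: f)
  case 0
  have "continuous_on UNIV (\<lambda>x. q + l x)"
    using l by (intro continuous_on_add continuous_on_const linear_continuous_on)
      (simp add: linear_conv_bounded_linear)
  with 0 show ?case by (auto intro: continuous_on_compose2)
next
  case (Suc k)
  then have d: "f differentiable (at y)" for y by simp
  note D = has_derivative_compose_affine[OF l d]
  have "C_k k (\<lambda>x. frechet_derivative (\<lambda>x. f (q + l x)) (at x) b)" for b
  proof -
    have "frechet_derivative f (at y) (l b)
        = (\<Sum>e\<in>Basis. (l b \<bullet> e) *\<^sub>R frechet_derivative f (at y) e)" for y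
    proof -
      have lin: "linear (frechet_derivative f (at y))"
        using d linear_frechet_derivative by blast
      have "frechet_derivative f (at y) (\<Sum>e\<in>Basis. (l b \<bullet> e) *\<^sub>R e)
          = (\<Sum>e\<in>Basis. (l b \<bullet> e) *\<^sub>R frechet_derivative f (at y) e)"
        by (simp add: linear_sum[OF lin] linear_cmul[OF lin])
      then show ?thesis by (simp add: euclidean_representation)
    qed
    then have "(\<lambda>x. frechet_derivative (\<lambda>x. f (q + l x)) (at x) b)
        = (\<lambda>x. \<Sum>e\<in>Basis. (l b \<bullet> e) *\<^sub>R frechet_derivative f (at (q + l x)) e)"
      by (simp add: frechet_derivative_at[OF D, symmetric])
    moreover have "C_k k (\<lambda>x. \<Sum>e\<in>Basis. (l b \<bullet> e) *\<^sub>R frechet_derivative f (at (q + l x)) e)"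
      using Suc by (intro C_k_sum C_k_bounded_linear[OF bounded_linear_scaleR_right] Suc.IH) auto
    ultimately show ?thesis by simp
  qed
  then show ?case using D by (auto simp: differentiable_def)
qed

lemma smooth_affine: "linear l \<Longrightarrow> smooth f \<Longrightarrow> smooth (\<lambda>x. f (q + l x))"
  by (simp add: smooth_def C_k_affine)

lemma smooth_linear: "bounded_linear L \<Longrightarrow> smooth f \<Longrightarrow> smooth (\<lambda>x. L (f x))"
  by (simp add: smooth_def C_k_bounded_linear)

lemma smooth_differentiable: "smooth f \<Longrightarrow> f differentiable (at x)"
  unfolding smooth_def by (metis C_k.simps(2))

lemma jacobian_outside_support:
  fixes v :: "real^'n \<Rightarrow> real^'m"
  assumes "x \<notin> closure {x. v x \<noteq> 0}"
  shows "jacobian v (at x) = 0"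
proof -
  have "((\<lambda>x. 0) has_derivative (\<lambda>h. 0)) (at x)" by simp
  then have "(v has_derivative (\<lambda>h. 0)) (at x)"
    by (rule has_derivative_transform_within_open[where s = "- closure {x. v x \<noteq> 0}"])
      (use assms closure_subset[of "{x. v x \<noteq> 0}"] in auto)
  then show ?thesis
    by (simp add: jacobian_def frechet_derivative_at[symmetric] matrix_def zero_vec_def)
qed

lemma jacobian_affine:
  fixes v :: "real^'n \<Rightarrow> real^'m" and S :: "real^'m^'k" and R :: "real^'l^'n"
  assumes v: "v differentiable (at (q + R *v x))"
  shows "jacobian (\<lambda>x. S *v v (q + R *v x)) (at x) = S ** jacobian v (at (q + R *v x)) ** R"
proof -
  have "((\<lambda>x. v (q + R *v x)) has_derivative (\<lambda>h. jacobian v (at (q + R *v x)) *v (R *v h))) (at x)"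
  proof -
    have "(v has_derivative (\<lambda>h. jacobian v (at (q + R *v x)) *v h)) (at (q + R *v x))"
      using v by (simp only: jacobian_works)
    then show ?thesis
      using has_derivative_compose_affine[OF matrix_vector_mul_linear v]
      by (simp only: frechet_derivative_at[symmetric])
  qed
  then have "((\<lambda>x. S *v v (q + R *v x)) has_derivative
      (\<lambda>h. S *v (jacobian v (at (q + R *v x)) *v (R *v h)))) (at x)"
    by (rule bounded_linear.has_derivative[OF matrix_vector_mul_bounded_linear])
  then have "((\<lambda>x. S *v v (q + R *v x)) has_derivative
      (*v) (S ** jacobian v (at (q + R *v x)) ** R)) (at x)"
    by (simp add: matrix_vector_mul_assoc matrix_mul_assoc)
  then show ?thesis
    unfolding jacobian_def[of "\<lambda>x. S *v v (q + R *v x)"]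
    by (simp add: frechet_derivative_at[symmetric])
qed

section \<open>Quasiconvexity under linear changes of variables\<close>

lemma add_matrix_matrix_mult:
  fixes A B :: "'a::semiring_1^'n^'m" and C :: "'a^'k^'n"
  shows "(A + B) ** C = A ** C + B ** C"
  by (simp add: matrix_matrix_mult_def vec_eq_iff distrib_right sum.distrib)

lemma emeasure_unit_cube: "emeasure lebesgue (box 0 (1 :: real^'n)) = 1"
proof -
  have "(1 :: real^'n) \<bullet> b = 1" if "b \<in> Basis" for b
    using that by (auto simp: Basis_vec_def inner_axis)
  then show ?thesis by (simp add: emeasure_lborel_box_eq)
qed

text \<open>
  Outside the cube the derivative of a test function vanishes, so the integral of the excess over the
  cube equals the integral over the whole space; and as the cube has measure one, subtracting the
  constant \<open>\<psi> A\<close> under the integral is subtracting it outside. The cube now only enters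
  through the supports of the test functions.
\<close>

lemma quasiconvex_iff_excess:
  fixes \<psi> :: "real^'n^'m \<Rightarrow> real"
  shows "quasiconvex \<psi> \<longleftrightarrow>
    (\<forall>A. \<forall>v \<in> test_functions (box 0 1) :: (real^'n \<Rightarrow> real^'m) set.
       integrable lebesgue (\<lambda>x. \<psi> (A + jacobian v (at x)) - \<psi> A) \<and>
       0 \<le> (LINT x|lebesgue. \<psi> (A + jacobian v (at x)) - \<psi> A))"
proof -
  have "(set_integrable lebesgue (box 0 1) (\<lambda>x. \<psi> (A + jacobian v (at x))) \<and>
        \<psi> A \<le> (LINT x:box 0 1|lebesgue. \<psi> (A + jacobian v (at x)))) \<longleftrightarrow>
      (integrable lebesgue (\<lambda>x. \<psi> (A + jacobian v (at x)) - \<psi> A) \<and>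
       0 \<le> (LINT x|lebesgue. \<psi> (A + jacobian v (at x)) - \<psi> A))"
    if v: "v \<in> test_functions (box 0 1)" for A and v :: "real^'n \<Rightarrow> real^'m"
  proof -
    let ?Q = "box 0 1 :: (real^'n) set"
    let ?F = "\<lambda>x. \<psi> (A + jacobian v (at x))"
    have E: "(\<lambda>x. ?F x - \<psi> A) = (\<lambda>x. indicator ?Q x *\<^sub>R (?F x - \<psi> A))"
      using v jacobian_outside_support[of _ v]
      by (fastforce simp: test_functions_def indicator_def fun_eq_iff)
    have const: "set_integrable lebesgue ?Q (\<lambda>x. \<psi> A)"
      unfolding set_integrable_def
      by (intro integrable_scaleR_left integrable_real_indicator) (simp_all add: emeasure_unit_cube)
    have "measure lebesgue ?Q = 1"
      using emeasure_unit_cube[where 'n='n] by (simp add: measure_def)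
    then have const_int: "(LINT x:?Q|lebesgue. \<psi> A) = \<psi> A"
      by (simp add: set_lebesgue_integral_def)
    have "set_integrable lebesgue ?Q ?F \<longleftrightarrow> set_integrable lebesgue ?Q (\<lambda>x. ?F x - \<psi> A)"
      using set_integral_diff(1)[OF _ const, of ?F] set_integral_add(1)[OF _ const, of "\<lambda>x. ?F x - \<psi> A"]
      by auto
    then have i: "set_integrable lebesgue ?Q ?F \<longleftrightarrow> integrable lebesgue (\<lambda>x. ?F x - \<psi> A)"
      unfolding set_integrable_def[of _ _ "\<lambda>x. ?F x - \<psi> A"] E[symmetric] .
    have "(LINT x:?Q|lebesgue. ?F x) - \<psi> A = (LINT x|lebesgue. ?F x - \<psi> A)"
      if "set_integrable lebesgue ?Q ?F"
      using set_integral_diff(2)[OF that const]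
      unfolding const_int set_lebesgue_integral_def[of _ _ "\<lambda>x. ?F x - \<psi> A"] E[symmetric] by simp
    then show ?thesis using i by auto
  qed
  then show ?thesis unfolding quasiconvex_def by blast
qed

text \<open>
  Quasiconvexity of \<open>\<psi>\<close> is tested with \<open>V x = (1/c) S v (T x)\<close>, where \<open>T\<close> is the affine map with linear
  part \<open>c R\<close> that fixes the centre of the cube. Its derivative is \<open>S Dv(T x) R\<close>, and \<open>V\<close> is
  supported in the cube if \<open>c\<close> is large. The excess of \<open>\<psi>\<close> along \<open>V\<close> is then the composition
  of \<open>T\<close> with the excess along \<open>v\<close> of the transformed function.
\<close>

lemma quasiconvex_linear_change:
  fixes \<psi> :: "real^'n^'m \<Rightarrow> real" and S :: "real^'k^'m" and R :: "real^'n^'n"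
  assumes \<psi>: "quasiconvex \<psi>" and R: "invertible R"
  shows "quasiconvex (\<lambda>A. \<psi> (S ** A ** R))"
  unfolding quasiconvex_iff_excess
proof (intro allI ballI)
  fix A and v :: "real^'n \<Rightarrow> real^'k"
  assume v: "v \<in> test_functions (box 0 1)"
  define K where "K = closure {x. v x \<noteq> 0}"
  have K: "compact K" "K \<subseteq> box 0 1" and smooth_v: "smooth v"
    using v by (auto simp: K_def test_functions_def)
  define x0 :: "real^'n" where "x0 = (1/2) *\<^sub>R 1"
  have "x0 \<in> box 0 1" by (simp add: x0_def mem_box_cart)
  then obtain e where e: "e > 0" "ball x0 e \<subseteq> box 0 1"
    using open_contains_ball[of "box 0 1 :: (real^'n) set"] open_box by blast
  obtain R' where R': "R ** R' = mat 1" "R' ** R = mat 1"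
    using R by (auto simp: invertible_def)
  have R'_inv [simp]: "R *v (R' *v y) = y" "R' *v (R *v y) = y" for y
    by (simp_all add: matrix_vector_mul_assoc R')
  have "compact ((\<lambda>y. R' *v (y - x0)) ` K)"
    by (intro compact_continuous_image K continuous_intros matrix_vector_mult_linear_continuous_on
        continuous_on_compose2[of UNIV "(*v) R'"]) auto
  then obtain M where M: "M > 0" "\<And>y. y \<in> K \<Longrightarrow> norm (R' *v (y - x0)) \<le> M"
    by (force dest: compact_imp_bounded simp: bounded_pos)
  \<comment> \<open>Contracting by \<open>c\<close> takes the support, which \<open>R'\<close> keeps within \<open>M\<close> of \<open>x0\<close>, to within \<open>e/2\<close>.\<close>
  define c where "c = 2 * M / e"
  have c: "c > 0" "M / c < e" using M(1) e(1) by (simp_all add: c_def)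
  define q where "q = x0 - c *\<^sub>R (R *v x0)"
  define T where "T x = q + (c *\<^sub>R R) *v x" for x
  define q' where "q' = x0 - (1/c) *\<^sub>R (R' *v x0)"
  \<comment> \<open>\<open>U\<close> is the inverse of \<open>T\<close>. Both are stored as a constant plus a linear map, the form needed for smoothness and integration.\<close>
  define U where "U y = q' + ((1/c) *\<^sub>R R') *v y" for y
  have T: "T x = x0 + c *\<^sub>R (R *v (x - x0))" for x
    by (simp add: T_def q_def matrix_vector_mult_diff_distrib scaleR_matrix_vector_assoc[symmetric] algebra_simps)
  have U: "U y = x0 + (1/c) *\<^sub>R (R' *v (y - x0))" for y
    by (simp add: U_def q'_def matrix_vector_mult_diff_distrib scaleR_matrix_vector_assoc[symmetric] algebra_simps)
  have TU: "T (U y) = y" and UT: "U (T x) = x" for x y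
    using c(1) by (simp_all add: T U matrix_vector_mult_scaleR)
  define V where "V x = ((1/c) *\<^sub>R S) *v v (T x)" for x
  have V: "V \<in> test_functions (box 0 1)"
  proof -
    have supp: "{x. V x \<noteq> 0} \<subseteq> U ` K"
    proof
      fix x assume "x \<in> {x. V x \<noteq> 0}"
      then have "T x \<in> K" using closure_subset[of "{x. v x \<noteq> 0}"] by (auto simp: V_def K_def)
      then show "x \<in> U ` K" using UT by (metis imageI)
    qed
    have cUK: "compact (U ` K)"
      unfolding U_def
      by (intro compact_continuous_image K continuous_intros matrix_vector_mult_linear_continuous_on)
    with supp have cl: "closure {x. V x \<noteq> 0} \<subseteq> U ` K"
      by (intro closure_minimal compact_imp_closed)
    have "U ` K \<subseteq> ball x0 e"
    proof
      fix x assume "x \<in> U ` K"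
      then obtain y where y: "y \<in> K" "x = U y" by blast
      have "dist x0 x = norm (R' *v (y - x0)) / c"
        using c(1) by (simp add: y(2) U dist_norm)
      also have "\<dots> \<le> M / c" using M(2)[OF y(1)] c(1) by (simp add: divide_right_mono)
      finally show "x \<in> ball x0 e" using c(2) by simp
    qed
    then have "closure {x. V x \<noteq> 0} \<subseteq> box 0 1" using cl e(2) by blast
    moreover have "compact (closure {x. V x \<noteq> 0})"
      using bounded_subset[OF compact_imp_bounded[OF cUK] supp] by simp
    moreover have "smooth V"
      unfolding V_def T_def
      by (rule smooth_linear[OF matrix_vector_mul_bounded_linear])
        (rule smooth_affine[OF matrix_vector_mul_linear smooth_v])
    ultimately show ?thesis by (simp add: test_functions_def)
  qed
  have jac: "jacobian V (at x) = S ** jacobian v (at (T x)) ** R" for x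
    unfolding V_def T_def
    using c(1) by (simp add: jacobian_affine smooth_differentiable[OF smooth_v]
        matrix_scalar_ac scalar_matrix_assoc[symmetric])
  define E where "E y = \<psi> (S ** (A + jacobian v (at y)) ** R) - \<psi> (S ** A ** R)" for y
  have "(\<lambda>x. \<psi> (S ** A ** R + jacobian V (at x)) - \<psi> (S ** A ** R)) = (\<lambda>x. E (T x))"
    by (simp add: E_def jac matrix_add_ldistrib add_matrix_matrix_mult)
  then have ET: "integrable lebesgue (\<lambda>x. E (T x))" "0 \<le> (LINT x|lebesgue. E (T x))"
    using \<psi>[unfolded quasiconvex_iff_excess, rule_format, OF V, of "S ** A ** R"] by simp_all
  have inj: "inj ((*v) ((1/c) *\<^sub>R R'))"
    using c(1) by (intro inj_on_inverseI[where g = "(*v) (c *\<^sub>R R)"])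
      (simp add: scaleR_matrix_vector_assoc[symmetric] matrix_vector_mult_scaleR)
  obtain \<kappa> where \<kappa>: "\<kappa> > 0" "\<forall>k :: real^'n \<Rightarrow> real. integrable lebesgue k \<longrightarrow>
       integrable lebesgue (\<lambda>y. k (U y)) \<and> (LINT y|lebesgue. k (U y)) = \<kappa> * (LINT x|lebesgue. k x)"
    using lebesgue_integral_affine[OF matrix_vector_mul_linear inj, of q'] by (auto simp: U_def)
  show "integrable lebesgue (\<lambda>x. \<psi> (S ** (A + jacobian v (at x)) ** R) - \<psi> (S ** A ** R)) \<and>
      0 \<le> (LINT x|lebesgue. \<psi> (S ** (A + jacobian v (at x)) ** R) - \<psi> (S ** A ** R))"
    using \<kappa>(1) \<kappa>(2)[rule_format, OF ET(1)] ET(2) unfolding TU E_def by simp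
qed

lemma quasiconvexification_linear_change_le:
  fixes f :: "real^'n^'m \<Rightarrow> real"
  assumes "\<And>A. f (S ** A ** R) = f A" and "invertible R"
  shows "quasiconvexification f (S ** A ** R) \<le> quasiconvexification f A"
  unfolding quasiconvexification_def
proof (rule SUP_mono)
  fix g assume "g \<in> {g. (\<forall>B. g B \<le> f B) \<and> quasiconvex g}"
  then have "(\<lambda>A. g (S ** A ** R)) \<in> {g. (\<forall>B. g B \<le> f B) \<and> quasiconvex g}"
    using quasiconvex_linear_change[OF _ assms(2), of g S] by (auto) (metis assms(1))
  then show "\<exists>h \<in> {g. (\<forall>B. g B \<le> f B) \<and> quasiconvex g}. ereal (g (S ** A ** R)) \<le> ereal (h A)"
    by (rule bexI[rotated]) simp
qed

text \<open>
  The symmetry of \<open>f\<close> under \<open>S\<close> and \<open>R\<close> is also a symmetry under their inverses, so the inequality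
  of \<open>quasiconvexification_linear_change_le\<close> can be applied a second time, to the inverses.
\<close>

lemma quasiconvexification_linear_change:
  fixes f :: "real^'n^'m \<Rightarrow> real" and S :: "real^'m^'m" and R :: "real^'n^'n"
  assumes f: "\<And>A. f (S ** A ** R) = f A" and S: "invertible S" and R: "invertible R"
  shows "quasiconvexification f (S ** A ** R) = quasiconvexification f A"
proof (rule antisym)
  show "quasiconvexification f (S ** A ** R) \<le> quasiconvexification f A"
    using f R by (rule quasiconvexification_linear_change_le)
  obtain S' where S': "S ** S' = mat 1" "S' ** S = mat 1" using S by (auto simp: invertible_def)
  obtain R' where R': "R ** R' = mat 1" "R' ** R = mat 1" using R by (auto simp: invertible_def)
  have cancel: "S ** (S' ** B ** R') ** R = B" "S' ** (S ** B ** R) ** R' = B" for B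
    using S' R' by (simp_all add: matrix_mul_assoc) (simp_all flip: matrix_mul_assoc)
  have "f (S' ** B ** R') = f B" for B
    using f[of "S' ** B ** R'"] by (simp add: cancel)
  moreover have "invertible R'" using R' by (auto simp: invertible_def)
  ultimately have "quasiconvexification f (S' ** (S ** A ** R) ** R') \<le> quasiconvexification f (S ** A ** R)"
    by (rule quasiconvexification_linear_change_le)
  then show "quasiconvexification f A \<le> quasiconvexification f (S ** A ** R)"
    by (simp add: cancel)
qed

section \<open>Invariance of Hausdorff measure under isometries\<close>

lemma isometry_inv:
  fixes \<phi> :: "'a::metric_space \<Rightarrow> 'a"
  assumes "\<And>x y. dist (\<phi> x) (\<phi> y) = dist x y" "surj \<phi>"
  shows "dist (inv \<phi> x) (inv \<phi> y) = dist x y"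
  by (metis assms surj_f_inv_f)

text \<open>
  An isometry preserves diameters, and so maps covers of \<open>S\<close> to covers of its image of the same size.
\<close>

lemma hausdorff_outer_isometry_le:
  fixes \<phi> :: "'a::metric_space \<Rightarrow> 'b::metric_space"
  assumes iso: "\<And>x y. dist (\<phi> x) (\<phi> y) = dist x y"
  shows "hausdorff_outer k (\<phi> ` S) \<le> hausdorff_outer k S"
proof -
  have diam: "diameter (\<phi> ` C) = diameter C" for C
  proof -
    have "(\<lambda>(x, y). dist x y) ` (\<phi> ` C \<times> \<phi> ` C) = (\<lambda>(x, y). dist x y) ` (C \<times> C)"
      by (force simp: iso image_iff)
    then show ?thesis unfolding diameter_def by simp
  qed
  have bdd: "bounded (\<phi> ` C)" if "bounded C" for C
    using that by (auto simp: bounded_two_points iso)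
  have size: "hausdorff_size k (\<phi> ` C) = hausdorff_size k C" for C
    by (simp add: hausdorff_size_def diam)
  show ?thesis
    unfolding hausdorff_outer_def
  proof (intro SUP_mono bexI INF_mono)
    fix \<delta> C assume "C \<in> hausdorff_covers \<delta> S"
    then show "(\<lambda>i. \<phi> ` C i) \<in> hausdorff_covers \<delta> (\<phi> ` S)"
      by (fastforce simp: hausdorff_covers_def diam bdd)
    show "(\<Sum>i. hausdorff_size k (\<phi> ` C i)) \<le> (\<Sum>i. hausdorff_size k (C i))"
      by (simp add: size)
  qed
qed

lemma hausdorff_outer_isometry:
  fixes \<phi> :: "'a::metric_space \<Rightarrow> 'a"
  assumes iso: "\<And>x y. dist (\<phi> x) (\<phi> y) = dist x y" and "surj \<phi>"
  shows "hausdorff_outer k (\<phi> -` S) = hausdorff_outer k S"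
proof (rule antisym)
  have "inj \<phi>" by (rule injI) (metis iso dist_eq_0_iff)
  then have "\<phi> -` S = inv \<phi> ` S"
    using \<open>surj \<phi>\<close> by (simp add: bij_vimage_eq_inv_image bij_def)
  then show "hausdorff_outer k (\<phi> -` S) \<le> hausdorff_outer k S"
    using hausdorff_outer_isometry_le[of "inv \<phi>"] isometry_inv[OF assms] by simp
  show "hausdorff_outer k S \<le> hausdorff_outer k (\<phi> -` S)"
    using hausdorff_outer_isometry_le[of \<phi> k "\<phi> -` S"] assms by simp
qed

lemma space_hausdorff_measure [simp]: "space (hausdorff_measure k) = UNIV"
  by (simp add: hausdorff_measure_def space_measure_of_conv)

text \<open>
  The sigma-algebra consists of the Caratheodory-measurable sets, which are described by the outer
  measure alone; every test set is itself a preimage under the bijection \<open>\<phi>\<close>.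
\<close>

lemma measurable_hausdorff_isometry:
  fixes \<phi> :: "'a::metric_space \<Rightarrow> 'a"
  assumes iso: "\<And>x y. dist (\<phi> x) (\<phi> y) = dist x y" and "surj \<phi>"
  shows "\<phi> \<in> hausdorff_measure k \<rightarrow>\<^sub>M hausdorff_measure k"
proof (rule measurableI)
  fix A :: "'a set" assume "A \<in> sets (hausdorff_measure k)"
  then have A: "hausdorff_outer k (A \<inter> X) + hausdorff_outer k (- A \<inter> X) = hausdorff_outer k X" for X
    by (simp add: sets_hausdorff_measure lambda_system_def Compl_eq_Diff_UNIV)
  have "hausdorff_outer k (\<phi> -` A \<inter> X) + hausdorff_outer k (- (\<phi> -` A) \<inter> X) = hausdorff_outer k X" for X
  proof -
    have "inj \<phi>" by (rule injI) (metis iso dist_eq_0_iff)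
    then have X: "X = \<phi> -` (\<phi> ` X)" by (simp add: inj_vimage_image_eq)
    show ?thesis
      using A[of "\<phi> ` X"]
        hausdorff_outer_isometry[OF assms, of k "A \<inter> \<phi> ` X"]
        hausdorff_outer_isometry[OF assms, of k "- A \<inter> \<phi> ` X"]
        hausdorff_outer_isometry[OF assms, of k "\<phi> ` X"]
      by (simp add: vimage_Compl flip: X)
  qed
  then show "\<phi> -` A \<inter> space (hausdorff_measure k) \<in> sets (hausdorff_measure k)"
    by (simp add: sets_hausdorff_measure lambda_system_def Compl_eq_Diff_UNIV)
qed simp

lemma distr_hausdorff_isometry:
  fixes \<phi> :: "'a::metric_space \<Rightarrow> 'a"
  assumes iso: "\<And>x y. dist (\<phi> x) (\<phi> y) = dist x y" and "surj \<phi>"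
  shows "distr (hausdorff_measure k) (hausdorff_measure k) \<phi> = hausdorff_measure k"
proof (rule measure_eqI)
  fix A :: "'a set" assume "A \<in> sets (distr (hausdorff_measure k) (hausdorff_measure k) \<phi>)"
  then show "emeasure (distr (hausdorff_measure k) (hausdorff_measure k) \<phi>) A
      = emeasure (hausdorff_measure k) A"
    using measurable_sets[OF measurable_hausdorff_isometry[OF assms], of A k]
    by (simp add: emeasure_distr measurable_hausdorff_isometry[OF assms]
        emeasure_hausdorff_measure hausdorff_outer_isometry[OF assms])
qed simp

section \<open>Symmetries of the limit potential and the local density\<close>

text \<open>
  For small \<open>t\<close> the vector \<open>t z\<close> is the difference of the points \<open>x + t z\<close> and \<open>x\<close> of \<open>\<Omega>\<close>.
\<close>

lemma eventually_scaleR_in_difference_set: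
  fixes \<Omega> :: "'a::real_normed_vector set"
  assumes "open \<Omega>" "x \<in> \<Omega>"
  shows "eventually (\<lambda>t. t *\<^sub>R z \<in> difference_set \<Omega>) (at_right 0)"
proof -
  have "((\<lambda>t. x + t *\<^sub>R z) \<longlongrightarrow> x + 0 *\<^sub>R z) (at_right 0)"
    by (intro tendsto_intros)
  then have "eventually (\<lambda>t. x + t *\<^sub>R z \<in> \<Omega>) (at_right 0)"
    using assms by (auto dest: topological_tendstoD)
  then show ?thesis
    by eventually_elim (use assms in \<open>force simp: difference_set_def\<close>)
qed

text \<open>
  \<open>Lim\<close> is a description of the point to which a function tends, and which points have this
  property depends only on the eventual values of the function.
\<close>

lemma Lim_cong_eventually:
  assumes "eventually (\<lambda>x. f x = g x) F"
  shows "Lim F f = Lim F g"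
  using tendsto_cong[OF assms] by (simp add: Topological_Spaces.Lim_def)

lemma limit_potential_rotate_target:
  fixes w :: "real^'n \<Rightarrow> real^'n \<Rightarrow> real^'m \<Rightarrow> real" and R :: "real^'m^'m"
  assumes "open \<Omega>" "x \<in> \<Omega>"
    and w: "\<And>z y. z \<in> difference_set \<Omega> \<Longrightarrow> w x z y = w x z (R *v y)"
  shows "limit_potential \<beta> w x z (R *v y) = limit_potential \<beta> w x z y"
  unfolding limit_potential_def
proof (rule Lim_cong_eventually)
  show "\<forall>\<^sub>F t in at_right 0. rescaled_potential \<beta> w x z (R *v y) t = rescaled_potential \<beta> w x z y t"
    using eventually_scaleR_in_difference_set[OF assms(1,2), of z]
  proof eventually_elim
    case (elim t)
    then show ?case
      using w[of "t *\<^sub>R z" "t *\<^sub>R y"] by (simp add: rescaled_potential_def scaleR_matrix_vector_assoc matrix_vector_mult_scaleR)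
  qed
qed

lemma limit_potential_rotate_source:
  fixes w :: "real^'n \<Rightarrow> real^'n \<Rightarrow> real^'m \<Rightarrow> real" and R :: "real^'n^'n"
  assumes "open \<Omega>" "x \<in> \<Omega>"
    and w: "\<And>z y. z \<in> difference_set \<Omega> \<Longrightarrow> R *v z \<in> difference_set \<Omega> \<Longrightarrow> w x z y = w x (R *v z) y"
  shows "limit_potential \<beta> w x (R *v z) y = limit_potential \<beta> w x z y"
  unfolding limit_potential_def
proof (rule Lim_cong_eventually)
  show "\<forall>\<^sub>F t in at_right 0. rescaled_potential \<beta> w x (R *v z) y t = rescaled_potential \<beta> w x z y t"
    using eventually_scaleR_in_difference_set[OF assms(1,2), of z]
      eventually_scaleR_in_difference_set[OF assms(1,2), of "R *v z"]
  proof eventually_elim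
    case (elim t)
    then show ?case
      using w[of "t *\<^sub>R z" "t *\<^sub>R y"] by (simp add: rescaled_potential_def matrix_vector_mult_scaleR)
  qed
qed

text \<open>
  As the limit potential is invariant under rotating its first argument by \<open>R\<close>, the integrand
  for \<open>A R\<close> at \<open>z\<close> is the integrand for \<open>A\<close> at \<open>R z\<close>; the sphere and its Hausdorff measure are
  invariant under \<open>R\<close>. Integrability supplies the measurability needed for the transformation of the
  integral.
\<close>

lemma local_density_rotate_source:
  fixes w :: "real^'n \<Rightarrow> real^'n \<Rightarrow> real^'m \<Rightarrow> real" and R :: "real^'n^'n"
  assumes R: "orthogonal_matrix R"
    and w: "\<And>z y. limit_potential \<beta> w x (R *v z) y = limit_potential \<beta> w x z y"
    and int: "set_integrable (hausdorff_measure (CARD('n) - 1)) (sphere 0 1)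
             (\<lambda>z. limit_potential \<beta> w x z (A *v z))"
  shows "local_density \<beta> w x (A ** R) = local_density \<beta> w x A"
proof -
  let ?H = "hausdorff_measure (CARD('n) - 1) :: (real^'n) measure"
  let ?F = "\<lambda>z. indicat_real (sphere 0 1) z *\<^sub>R limit_potential \<beta> w x z (A *v z)"
  have orth: "orthogonal_transformation ((*v) R)"
    using R by (simp add: orthogonal_transformation_matrix)
  then have surj: "surj ((*v) R)" by (rule orthogonal_transformation_surj)
  have iso: "dist (R *v u) (R *v v) = dist u v" for u v
    using orth by (simp add: orthogonal_transformation_isometry)
  have norm: "norm (R *v u) = norm u" for u
    using orth by (rule orthogonal_transformation_norm)
  have "local_density \<beta> w x (A ** R) = (LINT z|?H. ?F (R *v z))"
    unfolding local_density_def set_lebesgue_integral_def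
    by (simp add: w matrix_vector_mul_assoc[symmetric] indicator_def norm)
  also have "\<dots> = integral\<^sup>L (distr ?H ?H ((*v) R)) ?F"
    using int by (intro integral_distr[symmetric] measurable_hausdorff_isometry iso surj)
      (simp add: set_integrable_def)
  also have "\<dots> = local_density \<beta> w x A"
    by (simp add: distr_hausdorff_isometry[OF iso surj] local_density_def set_lebesgue_integral_def)
  finally show ?thesis .
qed

section \<open>Symmetry of the quasiconvexified density\<close>

theorem proposition3p2:
  fixes \<Omega> :: "(real^'n) set"
    and w :: "real^'n \<Rightarrow> real^'n \<Rightarrow> real^'m \<Rightarrow> real"
    and \<beta> :: real
    and W :: "real^'n \<Rightarrow> real^'n^'m \<Rightarrow> ereal"
  assumes "open \<Omega>" and "bounded \<Omega>" and "smooth_boundary \<Omega>"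
    and "AE x\<in>\<Omega> in lebesgue. \<forall>z y. \<exists>l. (rescaled_potential \<beta> w x z y \<longlongrightarrow> l) (at_right 0)"
    and "AE x\<in>\<Omega> in lebesgue. \<forall>z\<in>difference_set \<Omega>. \<forall>y. \<forall>R :: real^'m^'m.
           rotation_matrix R \<longrightarrow> w x z y = w x z (R *v y)"
    and "AE x\<in>\<Omega> in lebesgue. \<forall>z\<in>difference_set \<Omega>. \<forall>y. \<forall>R :: real^'n^'n.
           rotation_matrix R \<and> R *v z \<in> difference_set \<Omega> \<longrightarrow> w x z y = w x (R *v z) y"
    and "AE x\<in>\<Omega> in lebesgue. \<forall>A :: real^'n^'m.
           set_integrable (hausdorff_measure (CARD('n) - 1)) (sphere 0 1)
             (\<lambda>z. limit_potential \<beta> w x z (A *v z))"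
    and "\<And>x A. W x A = quasiconvexification (local_density \<beta> w x) A"
  shows "AE x\<in>\<Omega> in lebesgue. \<forall>A :: real^'n^'m.
           (\<forall>R :: real^'m^'m. rotation_matrix R \<longrightarrow> W x (R ** A) = W x A) \<and>
           (\<forall>R :: real^'n^'n. rotation_matrix R \<longrightarrow> W x (A ** R) = W x A)"
  using assms(5,6,7)
proof eventually_elim
  case (elim x)
  show ?case
  proof (intro impI allI conjI)
    fix A :: "real^'n^'m" and R :: "real^'m^'m"
    assume "x \<in> \<Omega>" and R: "rotation_matrix R"
    have "limit_potential \<beta> w x z (R *v y) = limit_potential \<beta> w x z y" for z y
      using elim(1) \<open>x \<in> \<Omega>\<close> R by (intro limit_potential_rotate_target[OF \<open>open \<Omega>\<close>]) blast+
    then have "local_density \<beta> w x (R ** B) = local_density \<beta> w x B" for B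
      by (simp add: local_density_def matrix_vector_mul_assoc[symmetric])
    then show "W x (R ** A) = W x A"
      using quasiconvexification_linear_change[of "local_density \<beta> w x" R "mat 1" A] R
      by (simp add: assms(8) rotation_matrix_def invertible_det_nz)
  next
    fix A :: "real^'n^'m" and R :: "real^'n^'n"
    assume "x \<in> \<Omega>" and R: "rotation_matrix R"
    have "limit_potential \<beta> w x (R *v z) y = limit_potential \<beta> w x z y" for z y
      using elim(2) \<open>x \<in> \<Omega>\<close> R by (intro limit_potential_rotate_source[OF \<open>open \<Omega>\<close>]) blast+
    then have "local_density \<beta> w x (B ** R) = local_density \<beta> w x B" for B
      using elim(3) \<open>x \<in> \<Omega>\<close> R
      by (intro local_density_rotate_source) (auto simp: rotation_matrix_def)
    then show "W x (A ** R) = W x A"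
      using quasiconvexification_linear_change[of "local_density \<beta> w x" "mat 1" R A] R
      by (simp add: assms(8) rotation_matrix_def invertible_det_nz)
  qed
qed

end
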